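(* Let $d\ge 2$ and $n\ge 2$ be integers. Suppose that a $d$-dimensional cube in $\mathbb{R}^d$ can be decomposed into precisely $n$ smaller cubes, all of whose side lengths belong to the interval $\left(1-\frac{1}{n^{1/d}+1},\,1\right]$. Then $n$ is a perfect $d$-th power, that is, $n=m^d$ for some positive integer $m$. Moreover, in this case the $n$ small cubes of the decomposition must all be congruent (that is, they all have the same side length).
   Context: A decomposition (tessellation, tiling) of a $d$-dimensional cube $Q\subset\mathbb{R}^d$ into $n$ smaller cubes is a family of $n$ closed $d$-dimensional cubes (of positive side length) with pairwise disjoint interiors whose union is $Q$. The side length of the decomposed cube $Q$ is an arbitrary positive real number. *)

theory Defs
  imports "HOL-Analysis.Analysis"
begin

text \<open>Cubes need not be axis-parallel: a cube of side length \<open>s\<close> is any image of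
  \<open>[0, s]\<^sup>d\<close> under a rigid motion (a linear isometry followed by a translation).\<close>

definition is_cube :: "real \<Rightarrow> (real ^ 'd) set \<Rightarrow> bool" where
  "is_cube s C \<longleftrightarrow>
     s > 0 \<and>
     (\<exists>(f :: real ^ 'd \<Rightarrow> real ^ 'd) p. orthogonal_transformation f \<and> C = (\<lambda>x. p + f x) ` cbox 0 (\<chi> i. s))"

text \<open>The function \<open>a\<close> records the side lengths; as cubes have nonempty interior,
  disjointness of interiors forces the \<open>n\<close> members of the family to be distinct sets.\<close>

definition cube_decomposition ::
    "(real ^ 'd) set \<Rightarrow> nat \<Rightarrow> (nat \<Rightarrow> (real ^ 'd) set) \<Rightarrow> (nat \<Rightarrow> real) \<Rightarrow> bool" where
  "cube_decomposition Q n C a \<longleftrightarrow>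
     (\<forall>i<n. is_cube (a i) (C i)) \<and>
     (\<forall>i<n. \<forall>j<n. i \<noteq> j \<longrightarrow> interior (C i) \<inter> interior (C j) = {}) \<and>
     (\<Union>i<n. C i) = Q"

end

theory Submission
  imports Defs
begin

text \<open>All cubes of the decomposition are parallel to \<open>Q\<close>, so take \<open>Q = [0, s]\<^sup>d\<close>. Put
  \<open>N = n\<^sup>1\<^sup>/\<^sup>d\<close>. Comparing volumes gives \<open>s \<le> N\<close>, and since all sides lie in \<open>(N/(N+1), 1]\<close>, every
  axis-parallel line in general position meets exactly \<open>k = \<lceil>s\<rceil>\<close> cubes. Similarly, the number of cubes
  below a given cube in each direction is well enough determined by its position to yield an injection
  of the cubes into \<open>{0..<k}\<^sup>d\<close>, hence \<open>n \<le> k\<^sup>d\<close>. Conversely, integrating the line count over \<open>Q\<close> gives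
  \<open>\<Sum> a\<^sub>i\<^sup>d\<^sup>-\<^sup>1 = k s\<^sup>d\<^sup>-\<^sup>1\<close>, while \<open>\<Sum> a\<^sub>i\<^sup>d = s\<^sup>d\<close>; summing \<open>(d-1) t\<^sup>d - d t\<^sup>d\<^sup>-\<^sup>1 + 1 \<ge> 0\<close> over \<open>t = k a\<^sub>i / s\<close>
  gives \<open>n \<ge> k\<^sup>d\<close>, with equality only if every \<open>t\<close> is 1.\<close>

section \<open>Cubes in a decomposition are parallel\<close>

text \<open>The vectors \<open>F l\<close> are orthonormal with nonnegative entries, so every term
  of the inner product of two of them vanishes and their supports are disjoint. Disjoint nonempty
  supports, one for each coordinate, must be singletons, and unit length makes the remaining entry
  1.\<close>

lemma signed_orthonormal_imp_permutation:
  fixes f :: "real ^ 'd \<Rightarrow> real ^ 'd"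
  assumes f: "orthogonal_transformation f"
    and c: "\<And>l. c l = 1 \<or> c l = (-1::real)"
    and nonneg: "\<And>l m. 0 \<le> c l * f (axis l 1) $ m"
  obtains \<pi> where "bij \<pi>" and "\<And>x l. f x $ \<pi> l = c l * x $ l"
proof -
  define F where "F l = c l *\<^sub>R f (axis l 1)" for l
  have F_nonneg: "0 \<le> F l $ m" for l m
    using nonneg by (simp add: F_def)
  have inner_F: "F l \<bullet> F l' = (if l = l' then 1 else 0)" for l l'
  proof -
    have "f (axis l 1) \<bullet> f (axis l' 1) = (if l = l' then 1 else 0)"
      using f by (simp add: orthogonal_transformation_def inner_axis_axis)
    then show ?thesis using c[of l] by (auto simp: F_def)
  qed
  have "\<exists>m. F l $ m \<noteq> 0" for l
    using inner_F[of l l] by (metis inner_zero_left vec_eq_iff zero_index zero_neq_one)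
  then obtain \<pi> where \<pi>: "F l $ \<pi> l \<noteq> 0" for l by metis
  have disj: "F l $ m * F l' $ m = 0" if "l \<noteq> l'" for l l' m
  proof -
    have "(\<Sum>m\<in>UNIV. F l $ m * F l' $ m) = 0"
      using inner_F[of l l'] that by (simp add: inner_vec_def)
    then show ?thesis
      using F_nonneg by (subst (asm) sum_nonneg_eq_0_iff) auto
  qed
  have "inj \<pi>"
    by (rule injI) (metis disj \<pi> mult_eq_0_iff)
  then have "bij \<pi>"
    by (simp add: bij_def finite_UNIV_inj_surj)
  have zero: "F l $ m = 0" if "m \<noteq> \<pi> l" for l m
  proof -
    obtain l' where "m = \<pi> l'" using \<open>bij \<pi>\<close> by (metis bij_pointE)
    then show ?thesis using that disj[of l l' m] \<pi>[of l'] by auto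
  qed
  have one: "F l $ \<pi> l = 1" for l
  proof -
    have "(\<Sum>m\<in>UNIV. F l $ m * F l $ m) = (\<Sum>m\<in>{\<pi> l}. F l $ m * F l $ m)"
      by (rule sum.mono_neutral_right) (auto simp: zero)
    then have "F l $ \<pi> l * F l $ \<pi> l = 1"
      using inner_F[of l l] by (simp add: inner_vec_def)
    then show ?thesis using F_nonneg[of l "\<pi> l"]
      by (metis abs_of_nonneg abs_square_eq_1 power2_eq_square)
  qed
  have f_axis: "f (axis l 1) $ \<pi> l' = (if l = l' then c l else 0)" for l l'
  proof -
    have "c l * F l $ \<pi> l' = f (axis l 1) $ \<pi> l'"
      using c[of l] by (auto simp: F_def)
    moreover have "\<pi> l' \<noteq> \<pi> l" if "l \<noteq> l'"
      using that \<open>inj \<pi>\<close> by (auto dest: injD)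
    ultimately show ?thesis using one[of l] zero[of "\<pi> l'" l] by (cases "l = l'") auto
  qed
  have "f x $ \<pi> l = c l * x $ l" for x l
  proof -
    have "f x = f (\<Sum>l'\<in>UNIV. x $ l' *\<^sub>R axis l' 1)"
      by (metis basis_expansion scalar_mult_eq_scaleR)
    also have "\<dots> = (\<Sum>l'\<in>UNIV. x $ l' *\<^sub>R f (axis l' 1))"
      using orthogonal_transformation_linear[OF f]
      by (simp add: linear_sum linear_cmul)
    finally have "f x $ \<pi> l = (\<Sum>l'\<in>UNIV. x $ l' * f (axis l' 1) $ \<pi> l)"
      by simp
    also have "\<dots> = (\<Sum>l'\<in>UNIV. if l' = l then x $ l' * c l' else 0)"
      by (rule sum.cong) (auto simp: f_axis)
    finally show ?thesis by simp
  qed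
  with \<open>bij \<pi>\<close> show thesis by (rule that)
qed

lemma signed_permutation_image_cbox:
  fixes f :: "real ^ 'd \<Rightarrow> real ^ 'd"
  assumes f: "orthogonal_transformation f"
    and c: "\<And>l. c l = 1 \<or> c l = (-1::real)"
    and "bij \<pi>" and f\<pi>: "\<And>x l. f x $ \<pi> l = c l * x $ l"
  shows "\<exists>u. (\<lambda>x. p + f x) ` cbox 0 (\<chi> i. s) = cbox u (\<chi> i. u $ i + s)"
proof -
  \<comment> \<open>A coordinate with sign -1 sends the interval from 0 to \<open>s\<close> to the
    one from \<open>-s\<close> to 0, so its lower corner moves by \<open>-s\<close>.\<close>
  define u where "u = (\<chi> m. p $ m + (if c (inv \<pi> m) = 1 then 0 else - s))"
  have inv\<pi>: "inv \<pi> (\<pi> l) = l" for l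
    using \<open>bij \<pi>\<close> by (simp add: bij_is_inj)
  have all\<pi>: "(\<forall>m. P m) \<longleftrightarrow> (\<forall>l. P (\<pi> l))" for P
    using \<open>bij \<pi>\<close> by (metis bij_pointE)
  have iff: "p + f x \<in> cbox u (\<chi> i. u $ i + s) \<longleftrightarrow> x \<in> cbox 0 (\<chi> i. s)" for x
  proof -
    have "(u $ \<pi> l \<le> (p + f x) $ \<pi> l \<and> (p + f x) $ \<pi> l \<le> u $ \<pi> l + s) \<longleftrightarrow> 0 \<le> x $ l \<and> x $ l \<le> s" for l
      using c[of l] by (auto simp: u_def inv\<pi> f\<pi>)
    then show ?thesis
      unfolding mem_box_cart by (subst all\<pi>) simp
  qed
  have "y \<in> (\<lambda>x. p + f x) ` cbox 0 (\<chi> i. s)" if "y \<in> cbox u (\<chi> i. u $ i + s)" for y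
  proof -
    obtain x where "f x = y - p"
      using orthogonal_transformation_surj[OF f] by (metis surjD)
    then have "y = p + f x" by simp
    with that iff show ?thesis by auto
  qed
  then show ?thesis using iff by (intro exI[of _ u]) auto
qed

text \<open>From the preimage \<open>y\<close> of \<open>z\<close>, a small step along each axis,
  suitably signed, stays in the model cube. Its image stays in the orthant at \<open>z\<close>, so
  the signed images of the axis vectors have nonnegative entries, and an orthogonal map with this
  property is a signed permutation.\<close>

lemma cube_locally_in_orthant_imp_cbox:
  fixes C :: "(real ^ 'd) set"
  assumes "is_cube s C" and "z \<in> C" and "e > 0"
    and orth: "\<And>x m. x \<in> C \<Longrightarrow> dist x z < e \<Longrightarrow> z $ m \<le> x $ m"
  shows "\<exists>u. C = cbox u (\<chi> i. u $ i + s)"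
proof -
  obtain f :: "real ^ 'd \<Rightarrow> real ^ 'd" and p where s: "s > 0"
    and f: "orthogonal_transformation f" and C: "C = (\<lambda>x. p + f x) ` cbox 0 (\<chi> i. s)"
    using \<open>is_cube s C\<close> unfolding is_cube_def by blast
  obtain y where y: "y \<in> cbox 0 (\<chi> i. s)" and z: "z = p + f y"
    using \<open>z \<in> C\<close> C by auto
  define c where "c l = (if y $ l \<le> s / 2 then 1 else -1 :: real)" for l
  define t where "t = min (e / 2) (s / 2)"
  have t: "t > 0" "t < e" "t \<le> s / 2" using \<open>e > 0\<close> s by (auto simp: t_def)
  note lin = orthogonal_transformation_linear[OF f]
  have nonneg: "0 \<le> c l * f (axis l 1) $ m" for l m
  proof -
    let ?y = "y + (t * c l) *\<^sub>R axis l 1"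
    have "0 \<le> y $ i" "y $ i \<le> s" for i using y by (auto simp: mem_box_cart)
    moreover from this[of l] have "0 \<le> y $ l + t * c l" "y $ l + t * c l \<le> s"
      using t by (auto simp: c_def)
    ultimately have "?y \<in> cbox 0 (\<chi> i. s)"
      by (simp add: mem_box_cart axis_def)
    then have inC: "p + f ?y \<in> C" unfolding C by blast
    have eq: "p + f ?y = z + (t * c l) *\<^sub>R f (axis l 1)"
      using lin by (simp add: z linear_add linear_cmul)
    have "norm (f (axis l 1)) = 1"
      using f by (simp add: orthogonal_transformation_norm)
    then have "dist (p + f ?y) z < e"
      unfolding eq dist_norm using t by (simp add: c_def)
    from orth[OF inC this, of m] have "0 \<le> (t * c l) * f (axis l 1) $ m"
      unfolding eq by simp
    then show ?thesis using t by (simp add: mult.assoc zero_le_mult_iff)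
  qed
  have c: "c l = 1 \<or> c l = -1" for l by (simp add: c_def)
  obtain \<pi> where "bij \<pi>" and "\<And>x l. f x $ \<pi> l = c l * x $ l"
    using signed_orthonormal_imp_permutation[OF f c nonneg] by blast
  then show ?thesis
    unfolding C by (rule signed_permutation_image_cbox[OF f c])
qed

lemma is_cube_convex_body:
  fixes C :: "(real ^ 'd) set"
  assumes "is_cube s C"
  shows "compact C" "convex C" "interior C \<noteq> {}"
proof -
  obtain f :: "real ^ 'd \<Rightarrow> real ^ 'd" and p where s: "s > 0"
    and f: "orthogonal_transformation f" and C: "C = (\<lambda>x. p + f x) ` cbox 0 (\<chi> i. s)"
    using assms unfolding is_cube_def by blast
  note lin = orthogonal_transformation_linear[OF f]
  have C': "C = (+) p ` f ` cbox 0 (\<chi> i. s)" by (auto simp: C)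
  show "compact C"
    unfolding C' using lin
    by (intro compact_translation compact_continuous_image linear_continuous_on) (auto simp: linear_linear)
  show "convex C"
    unfolding C' using lin by (intro convex_translation convex_linear_image) auto
  have "box 0 (\<chi> i. s) \<noteq> ({} :: (real ^ 'd) set)"
    using s by (simp add: interval_ne_empty_cart)
  then show "interior C \<noteq> {}"
    unfolding C' interior_translation
    using interior_injective_linear_image[OF lin orthogonal_transformation_inj[OF f]]
    by (simp add: interior_cbox)
qed

section \<open>Local structure of boxes around a point\<close>

lemma interior_disjoint_closure:
  assumes "interior A \<inter> interior B = {}" and "closure (interior B) = B"
  shows "interior A \<inter> B = {}"
  using assms by (metis open_Int_closure_eq_empty open_interior)

text \<open>Within \<open>e\<close> of \<open>z\<close> the only face hyperplanes of the box that
  occur are those through \<open>z\<close>, so membership depends only on the sign pattern relative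
  to \<open>z\<close>.\<close>

lemma cbox_sgn_cong:
  fixes z :: "real ^ 'd"
  shows "\<exists>e>0. \<forall>x y. (\<forall>l. \<bar>x $ l - z $ l\<bar> < e \<and> \<bar>y $ l - z $ l\<bar> < e \<and> sgn (x $ l - z $ l) = sgn (y $ l - z $ l))
           \<longrightarrow> (x \<in> cbox u v \<longleftrightarrow> y \<in> cbox u v)"
proof -
  \<comment> \<open>Distance 0 belongs to faces through \<open>z\<close> and is discarded; the
    inserted 1 keeps the minimum defined when all faces pass through \<open>z\<close>.\<close>
  define D where "D = insert 1 (((\<lambda>l. \<bar>u $ l - z $ l\<bar>) ` UNIV \<union> (\<lambda>l. \<bar>v $ l - z $ l\<bar>) ` UNIV) - {0})"
  have fin: "finite D" "D \<noteq> {}" unfolding D_def by auto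
  define e where "e = Min D"
  have pos: "e > 0" unfolding e_def using fin by (auto simp: D_def)
  have le: "e \<le> d" if "d \<in> D" for d unfolding e_def using fin that by simp
  have u: "u $ l = z $ l \<or> e \<le> \<bar>u $ l - z $ l\<bar>" and v: "v $ l = z $ l \<or> e \<le> \<bar>v $ l - z $ l\<bar>" for l
    using le[of "\<bar>u $ l - z $ l\<bar>"] le[of "\<bar>v $ l - z $ l\<bar>"] by (auto simp: D_def)
  show ?thesis
  proof (intro exI[of _ e] conjI pos allI impI)
    fix x y
    assume A: "\<forall>l. \<bar>x $ l - z $ l\<bar> < e \<and> \<bar>y $ l - z $ l\<bar> < e \<and> sgn (x $ l - z $ l) = sgn (y $ l - z $ l)"
    have "(u $ l \<le> x $ l \<and> x $ l \<le> v $ l) \<longleftrightarrow> (u $ l \<le> y $ l \<and> y $ l \<le> v $ l)" for l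
      using A[rule_format, of l] u[of l] v[of l]
      by (auto simp: sgn_if abs_if split: if_splits)
    then show "x \<in> cbox u v \<longleftrightarrow> y \<in> cbox u v" by (simp add: mem_box_cart)
  qed
qed

lemma cbox_sgn_cong_finite:
  fixes z :: "real ^ 'd"
  assumes "finite \<B>" and "\<And>B. B \<in> \<B> \<Longrightarrow> \<exists>u v. B = cbox u v"
  shows "\<exists>e>0. \<forall>x y. (\<forall>l. \<bar>x $ l - z $ l\<bar> < e \<and> \<bar>y $ l - z $ l\<bar> < e \<and> sgn (x $ l - z $ l) = sgn (y $ l - z $ l))
           \<longrightarrow> (\<forall>B\<in>\<B>. x \<in> B \<longleftrightarrow> y \<in> B)"
  using assms
proof (induction \<B> rule: finite_induct)
  case empty
  then show ?case by (auto intro: exI[of _ 1])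
next
  case (insert B \<B>)
  obtain u v where B: "B = cbox u v" using insert.prems by blast
  obtain e1 where e1: "e1 > 0" "\<And>x y. (\<forall>l. \<bar>x $ l - z $ l\<bar> < e1 \<and> \<bar>y $ l - z $ l\<bar> < e1 \<and> sgn (x $ l - z $ l) = sgn (y $ l - z $ l))
           \<Longrightarrow> (\<forall>B\<in>\<B>. x \<in> B \<longleftrightarrow> y \<in> B)"
    using insert by (metis insert_iff)
  obtain e2 where e2: "e2 > 0" "\<And>x y. (\<forall>l. \<bar>x $ l - z $ l\<bar> < e2 \<and> \<bar>y $ l - z $ l\<bar> < e2 \<and> sgn (x $ l - z $ l) = sgn (y $ l - z $ l))
           \<Longrightarrow> (x \<in> B \<longleftrightarrow> y \<in> B)"
    using cbox_sgn_cong[of z u v] unfolding B by metis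
  show ?case
  proof (intro exI[of _ "min e1 e2"] conjI allI impI)
    show "min e1 e2 > 0" using e1 e2 by simp
    fix x y
    assume "\<forall>l. \<bar>x $ l - z $ l\<bar> < min e1 e2 \<and> \<bar>y $ l - z $ l\<bar> < min e1 e2 \<and> sgn (x $ l - z $ l) = sgn (y $ l - z $ l)"
    then show "\<forall>B\<in>insert B \<B>. x \<in> B \<longleftrightarrow> y \<in> B"
      using e1(2)[of x y] e2(2)[of x y] by simp
  qed
qed

text \<open>At a point minimising the coordinate sum over the cubes in skew position, the skew cubes can
  only occupy the positive orthant: any other orthant they meet would, being locally free of
  axis-parallel cubes, be occupied by them entirely and contain points with smaller sum.\<close>

lemma cube_decomposition_cbox_parallel:
  fixes C :: "nat \<Rightarrow> (real ^ 'd) set"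
  assumes "cube_decomposition (cbox v w) n C a"
  shows "\<forall>i<n. \<exists>u. C i = cbox u (\<chi> l. u $ l + a i)"
proof (rule ccontr)
  assume not: "\<not> ?thesis"
  have cube: "\<And>i. i < n \<Longrightarrow> is_cube (a i) (C i)"
    and disj: "\<And>i j. i < n \<Longrightarrow> j < n \<Longrightarrow> i \<noteq> j \<Longrightarrow> interior (C i) \<inter> interior (C j) = {}"
    and Q: "(\<Union>i<n. C i) = cbox v w"
    using assms unfolding cube_decomposition_def by auto
  define aligned where "aligned i \<longleftrightarrow> (\<exists>u. C i = cbox u (\<chi> l. u $ l + a i))" for i
  define R where "R = (\<Union>i\<in>{i. i < n \<and> \<not> aligned i}. C i)"
  have "compact R"
    unfolding R_def using cube is_cube_convex_body(1) by (intro compact_UN) auto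
  moreover have "R \<noteq> {}"
    using not is_cube_convex_body(3)[OF cube] interior_subset unfolding R_def aligned_def by fastforce
  moreover have "continuous_on R (\<lambda>x. \<Sum>l\<in>UNIV. x $ l)"
    by (intro continuous_intros)
  ultimately obtain z where z: "z \<in> R" and z_min: "\<And>x. x \<in> R \<Longrightarrow> (\<Sum>l\<in>UNIV. z $ l) \<le> (\<Sum>l\<in>UNIV. x $ l)"
    using continuous_attains_inf by metis
  obtain i where i: "i < n" "\<not> aligned i" "z \<in> C i" using z unfolding R_def by blast
  \<comment> \<open>The large box is included so that a move preserving the sign pattern about
    \<open>z\<close> cannot leave it.\<close>
  define \<B> where "\<B> = insert (cbox v w) (C ` {j. j < n \<and> aligned j})"
  have "\<exists>u v. B = cbox u v" if "B \<in> \<B>" for B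
    using that unfolding \<B>_def aligned_def by blast
  then obtain e where e: "e > 0" and cong: "\<And>x y. (\<forall>l. \<bar>x $ l - z $ l\<bar> < e \<and> \<bar>y $ l - z $ l\<bar> < e \<and> sgn (x $ l - z $ l) = sgn (y $ l - z $ l))
           \<Longrightarrow> (\<forall>B\<in>\<B>. x \<in> B \<longleftrightarrow> y \<in> B)"
    using cbox_sgn_cong_finite[of \<B> z] unfolding \<B>_def by auto
  have closure_interior: "closure (interior (C j)) = C j" if "j < n" for j
    using is_cube_convex_body[OF cube[OF that]]
    by (metis closure_closed compact_imp_closed convex_closure_interior)
  have int_orth: "z $ m \<le> x $ m" if x: "x \<in> interior (C i)" "dist x z < e" for x m
  proof (rule ccontr)
    assume neg: "\<not> z $ m \<le> x $ m"
    define d where "d = real CARD('d)"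
    have d: "d \<ge> 1" by (simp add: d_def Suc_leI)
    \<comment> \<open>\<open>y\<close> has the sign pattern of \<open>x\<close> about
      \<open>z\<close>. It loses \<open>e / 2\<close> in coordinate \<open>m\<close> and gains at
      most \<open>(d - 1) * (e / (2 * d))\<close>, which is less, in the others together, so its
      coordinate sum is below that of \<open>z\<close>.\<close>
    define y where "y = (\<chi> l. z $ l + (if l = m then - e / 2 else sgn (x $ l - z $ l) * (e / (2 * d))))"
    have xe: "\<bar>x $ l - z $ l\<bar> < e" for l
      using x(2) component_le_norm_cart[of "x - z" l] by (simp add: dist_norm)
    have "e / (2 * d) < e" using e d
      by (simp add: divide_less_eq)
    then have "\<forall>B\<in>\<B>. x \<in> B \<longleftrightarrow> y \<in> B"
      using neg e xe d by (intro cong) (auto simp: y_def sgn_if field_simps)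
    moreover have "x \<in> cbox v w" using x(1) Q i interior_subset by blast
    \<comment> \<open>An interior point of \<open>C i\<close> avoids even the boundaries of the
      aligned cubes; \<open>cong\<close> then transfers this to \<open>y\<close>, which leaves only
      non-aligned cubes to cover it.\<close>
    moreover have "x \<notin> C j" if "j < n" "aligned j" for j
      using interior_disjoint_closure[OF disj closure_interior, of i j] that i x(1) by blast
    ultimately have "y \<in> cbox v w" "\<And>j. j < n \<Longrightarrow> aligned j \<Longrightarrow> y \<notin> C j"
      unfolding \<B>_def by auto
    then have "y \<in> R" using Q unfolding R_def by blast
    then have "(\<Sum>l\<in>UNIV. z $ l) \<le> (\<Sum>l\<in>UNIV. y $ l)" by (rule z_min)
    moreover have "(\<Sum>l\<in>UNIV. y $ l - z $ l) < 0"
    proof -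
      have "(\<Sum>l\<in>UNIV. y $ l - z $ l) = - e / 2 + (\<Sum>l\<in>UNIV - {m}. sgn (x $ l - z $ l) * (e / (2 * d)))"
        by (subst sum.remove[of _ m]) (auto simp: y_def intro!: sum.cong)
      moreover have "(\<Sum>l\<in>UNIV - {m}. sgn (x $ l - z $ l) * (e / (2 * d))) \<le> (\<Sum>l\<in>UNIV - {m}. e / (2 * d))"
        using e d by (intro sum_mono) (auto simp: sgn_if)
      moreover have "(\<Sum>l\<in>UNIV - {m}. e / (2 * d)) = (d - 1) * (e / (2 * d))"
        by (simp add: card_Diff_singleton d_def)
      moreover have "- e / 2 + (d - 1) * (e / (2 * d)) < 0"
        using e d by (simp add: field_simps)
      ultimately show ?thesis by linarith
    qed
    ultimately show False by (simp add: sum_subtractf)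
  qed
  \<comment> \<open>Boundary points of \<open>C i\<close> are limits of interior points, and the
    half-space is closed.\<close>
  have "z $ m \<le> x $ m" if x: "x \<in> C i" "dist x z < e" for x m
  proof -
    have "x \<in> closure (ball z e \<inter> interior (C i))"
      using x closure_interior[OF i(1)] open_Int_closure_subset[of "ball z e" "interior (C i)"]
      by (auto simp: dist_commute)
    moreover have "closed {x :: real ^ 'd. z $ m \<le> x $ m}"
      by (intro closed_Collect_le continuous_intros)
    then have "closure (ball z e \<inter> interior (C i)) \<subseteq> {x. z $ m \<le> x $ m}"
      using int_orth by (intro closure_minimal) (auto simp: dist_commute)
    ultimately show ?thesis by blast
  qed
  then have "aligned i"
    unfolding aligned_def using cube_locally_in_orthant_imp_cbox[OF cube[OF i(1)] i(3) e] by blast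
  with i show False by simp
qed

text \<open>Serves to bring \<open>Q\<close> into standard position by undoing its own rigid motion,
  with the side lengths unchanged.\<close>

lemma cube_decomposition_rigid_image:
  fixes C :: "nat \<Rightarrow> (real ^ 'd) set" and g :: "real ^ 'd \<Rightarrow> real ^ 'd" and p :: "real ^ 'd"
  assumes g: "orthogonal_transformation g" and dec: "cube_decomposition Q n C a"
  defines "h \<equiv> \<lambda>x. g (x - p)"
  shows "cube_decomposition (h ` Q) n (\<lambda>i. h ` C i) a"
proof -
  note lin = orthogonal_transformation_linear[OF g]
  have h: "h ` S = g ` (+) (- p) ` S" for S by (auto simp: h_def image_image)
  have int: "interior (h ` S) = h ` interior S" for S
    unfolding h interior_injective_linear_image[OF lin orthogonal_transformation_inj[OF g]]
      interior_translation ..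
  have "inj h"
    unfolding h_def by (rule injI) (metis injD[OF orthogonal_transformation_inj[OF g]] diff_add_cancel)
  have cube: "is_cube s (h ` S)" if S: "is_cube s S" for s S
  proof -
    obtain f :: "real ^ 'd \<Rightarrow> real ^ 'd" and q where s: "s > 0"
      and f: "orthogonal_transformation f" and Seq: "S = (\<lambda>x. q + f x) ` cbox 0 (\<chi> i. s)"
      using S unfolding is_cube_def by blast
    have "h ` S = (\<lambda>x. g (q - p) + (g \<circ> f) x) ` cbox 0 (\<chi> i. s)"
      unfolding Seq h_def image_image
      by (intro image_cong refl) (simp add: linear_add[OF lin, symmetric] algebra_simps)
    then show ?thesis
      unfolding is_cube_def using s orthogonal_transformation_compose[OF g f] by blast
  qed
  have "interior (h ` C i) \<inter> interior (h ` C j) = {}" if "i < n" "j < n" "i \<noteq> j" for i j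
    using dec that \<open>inj h\<close> unfolding cube_decomposition_def int
    by (simp flip: image_Int)
  moreover have "(\<Union>i<n. h ` C i) = h ` Q"
    using dec unfolding cube_decomposition_def by blast
  moreover have "is_cube (a i) (h ` C i)" if "i < n" for i
    using dec cube that unfolding cube_decomposition_def by simp
  ultimately show ?thesis
    unfolding cube_decomposition_def by simp
qed

section \<open>Counting cubes along lines\<close>

text \<open>For positive \<open>t\<close>, division by \<open>t ^ Suc m\<close> gives Bernoulli's
  inequality for \<open>1 / t\<close>. The proof, which also covers \<open>t = 0\<close>, is an
  induction: the recurrence \<open>rec\<close> adds a product of two factors of equal sign. For
  \<open>m = 0\<close> the expression is identically 0, hence the restriction in the strict
  version.\<close>

lemma tangent_line_power:
  fixes t :: real
  assumes "t \<ge> 0"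
  shows "0 \<le> real m * t ^ Suc m - real (Suc m) * t ^ m + 1"
    and "m > 0 \<Longrightarrow> t \<noteq> 1 \<Longrightarrow> 0 < real m * t ^ Suc m - real (Suc m) * t ^ m + 1"
proof -
  let ?g = "\<lambda>m. real m * t ^ Suc m - real (Suc m) * t ^ m + 1"
  have rec: "?g (Suc m) = t * ?g m + (t - 1) * (t ^ Suc m - 1)" for m
    by (simp add: algebra_simps)
  have nn: "0 \<le> (t - 1) * (t ^ Suc m - 1)" for m
  proof (cases "t \<ge> 1")
    case True
    then show ?thesis by (intro mult_nonneg_nonneg) (simp_all add: one_le_power del: power_Suc)
  next
    case False
    then show ?thesis using assms
      by (intro mult_nonpos_nonpos) (simp_all add: power_le_one del: power_Suc)
  qed
  have pos: "0 < (t - 1) * (t ^ Suc m - 1)" if "t \<noteq> 1" for m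
  proof -
    have "t ^ Suc m \<noteq> 1" using that assms by (metis nat.simps(3) power_eq_1_iff real_norm_def abs_of_nonneg)
    then show ?thesis using nn[of m] that by (simp del: power_Suc add: less_le)
  qed
  show nonneg: "0 \<le> ?g m" for m
  proof (induction m)
    case (Suc m)
    then show ?case unfolding rec using assms nn[of m] by (metis add_nonneg_nonneg mult_nonneg_nonneg)
  qed simp
  assume "m > 0" "t \<noteq> 1"
  then obtain m' where m: "m = Suc m'" by (cases m) auto
  have "0 \<le> t * ?g m'" using assms nonneg by (rule mult_nonneg_nonneg)
  then show "0 < ?g m" unfolding m rec using pos[OF \<open>t \<noteq> 1\<close>, of m'] by linarith
qed

text \<open>The intervals overlap in null sets, so their lengths add up to the measure of the union.
  Coverage is asked only below \<open>b\<close> because in \<open>sum_hit_below\<close> the point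
  \<open>b\<close> is the lower end of the given cube, and possibly no cube before it reaches that
  far a priori.\<close>

lemma sum_lengths_tiled_interval:
  fixes u a :: "'i \<Rightarrow> real"
  assumes "finite I" and "0 \<le> b" and a: "\<And>i. i \<in> I \<Longrightarrow> 0 \<le> a i"
    and sep: "\<And>i i'. i \<in> I \<Longrightarrow> i' \<in> I \<Longrightarrow> i \<noteq> i' \<Longrightarrow> u i + a i \<le> u i' \<or> u i' + a i' \<le> u i"
    and sub: "\<And>i. i \<in> I \<Longrightarrow> 0 \<le> u i \<and> u i + a i \<le> b"
    and cover: "\<And>t. 0 \<le> t \<Longrightarrow> t < b \<Longrightarrow> \<exists>i\<in>I. u i \<le> t \<and> t \<le> u i + a i"
  shows "sum a I = b"
proof -
  let ?U = "\<Union>i\<in>I. {u i..u i + a i}"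
  have meas: "{x..y} \<in> lmeasurable" for x y :: real
    by (metis lmeasurable_cbox cbox_interval)
  have measure_Icc: "measure lebesgue {x..y} = y - x" if "x \<le> y" for x y :: real
    using that by (simp add: measure_completion)
  have U: "?U \<in> lmeasurable"
    using \<open>finite I\<close> meas by (intro fmeasurable.finite_UN) auto
  have "measure lebesgue ?U = (\<Sum>i\<in>I. measure lebesgue {u i..u i + a i})"
  proof (rule measure_negligible_finite_Union_image)
    show "pairwise (\<lambda>i i'. negligible ({u i..u i + a i} \<inter> {u i'..u i' + a i'})) I"
    proof (rule pairwiseI)
      fix i i' assume "i \<in> I" "i' \<in> I" "i \<noteq> i'"
      then have "{u i..u i + a i} \<inter> {u i'..u i' + a i'} \<subseteq> {u i, u i'}"
        using sep[of i i'] by auto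
      then show "negligible ({u i..u i + a i} \<inter> {u i'..u i' + a i'})"
        by (rule negligible_subset[rotated]) simp
    qed
  qed (use \<open>finite I\<close> meas in auto)
  also have "\<dots> = sum a I"
    using a measure_Icc by (intro sum.cong) auto
  finally have eq: "measure lebesgue ?U = sum a I" .
  have "measure lebesgue ?U \<le> measure lebesgue {0..b}"
    using U meas sub by (intro measure_mono_fmeasurable) (auto, fastforce+)
  moreover have "measure lebesgue {0..<b} \<le> measure lebesgue ?U"
    using U cover by (intro measure_mono_fmeasurable) auto
  moreover have "measure lebesgue {0..<b} = b"
    using \<open>0 \<le> b\<close> by (simp add: measure_completion)
  ultimately show ?thesis
    using measure_Icc[OF \<open>0 \<le> b\<close>] eq by simp
qed

lemma negligible_coordinate_hyperplane: "negligible {x :: real ^ 'd. x $ l = c}"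
  using negligible_hyperplane[of "axis l 1 :: real ^ 'd" c]
  by (simp add: inner_axis' axis_eq_0_iff)

section \<open>Tilings by axis-parallel cubes, in coordinates\<close>

locale cube_tiling =
  fixes s :: real and n :: nat and u :: "nat \<Rightarrow> real ^ 'd" and a :: "nat \<Rightarrow> real"
  assumes s_pos: "s > 0"
    and side_pos: "i < n \<Longrightarrow> 0 < a i"
    and cover: "(\<Union>i<n. cbox (u i) (\<chi> l. u i $ l + a i)) = cbox 0 (\<chi> l. s)"
    and separated: "i < n \<Longrightarrow> i' < n \<Longrightarrow> i \<noteq> i' \<Longrightarrow>
      \<exists>l. u i $ l + a i \<le> u i' $ l \<or> u i' $ l + a i' \<le> u i $ l"
begin

text \<open>Avoiding every face hyperplane makes weak and strict inequalities agree, so a closed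
  cube meeting an axis-parallel line through a generic point has its interior projection hit by that
  line.\<close>

definition generic :: "real ^ 'd \<Rightarrow> bool" where
  "generic x \<longleftrightarrow> x \<in> cbox 0 (\<chi> l. s) \<and> (\<forall>l. \<forall>i<n. x $ l \<noteq> u i $ l \<and> x $ l \<noteq> u i $ l + a i)"

text \<open>\<open>hit x j\<close> consists, for generic \<open>x\<close>, of the cubes met by the line through \<open>x\<close>
  in direction \<open>j\<close>.\<close>

definition hit :: "real ^ 'd \<Rightarrow> 'd \<Rightarrow> nat set" where
  "hit x j = {i. i < n \<and> (\<forall>l. l \<noteq> j \<longrightarrow> u i $ l < x $ l \<and> x $ l < u i $ l + a i)}"

lemma finite_hit: "finite (hit x j)"
  by (simp add: hit_def)

lemma corner_bounds:
  assumes "i < n"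
  shows "0 \<le> u i $ l" "u i $ l + a i \<le> s"
proof -
  have sub: "cbox (u i) (\<chi> l. u i $ l + a i) \<subseteq> cbox 0 (\<chi> l. s)"
    using cover assms by blast
  have "u i \<in> cbox (u i) (\<chi> l. u i $ l + a i)" "(\<chi> l. u i $ l + a i) \<in> cbox (u i) (\<chi> l. u i $ l + a i)"
    using side_pos[OF assms] by (auto simp: mem_box_cart less_imp_le)
  with sub have "u i \<in> cbox 0 (\<chi> l. s)" "(\<chi> l. u i $ l + a i) \<in> cbox 0 (\<chi> l. s)" by blast+
  then show "0 \<le> u i $ l" "u i $ l + a i \<le> s" by (auto simp: mem_box_cart)
qed

text \<open>In every coordinate other than \<open>j\<close> both cubes contain the coordinate of
  \<open>x\<close> strictly inside, so the separating axis can only be \<open>j\<close>.\<close>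

lemma hit_separated:
  assumes "i \<in> hit x j" "i' \<in> hit x j" "i \<noteq> i'"
  shows "u i $ j + a i \<le> u i' $ j \<or> u i' $ j + a i' \<le> u i $ j"
proof -
  obtain l where l: "u i $ l + a i \<le> u i' $ l \<or> u i' $ l + a i' \<le> u i $ l"
    using separated[of i i'] assms by (auto simp: hit_def)
  have "l = j"
  proof (rule ccontr)
    assume "l \<noteq> j"
    then have "u i $ l < x $ l" "x $ l < u i $ l + a i" "u i' $ l < x $ l" "x $ l < u i' $ l + a i'"
      using assms by (auto simp: hit_def)
    with l show False by linarith
  qed
  with l show ?thesis by simp
qed

lemma hit_cover:
  assumes "generic x" "0 \<le> t" "t \<le> s"
  shows "\<exists>i\<in>hit x j. u i $ j \<le> t \<and> t \<le> u i $ j + a i"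
proof -
  define y where "y = (\<chi> l. if l = j then t else x $ l)"
  have "y \<in> cbox 0 (\<chi> l. s)"
    using assms by (auto simp: y_def generic_def mem_box_cart)
  then obtain i where i: "i < n" "y \<in> cbox (u i) (\<chi> l. u i $ l + a i)"
    using cover by blast
  then have y: "u i $ l \<le> y $ l" "y $ l \<le> u i $ l + a i" for l
    by (auto simp: mem_box_cart)
  have "u i $ l < x $ l \<and> x $ l < u i $ l + a i" if "l \<noteq> j" for l
  proof -
    have "x $ l \<noteq> u i $ l" "x $ l \<noteq> u i $ l + a i"
      using assms(1) i(1) by (auto simp: generic_def)
    with y[of l] that show ?thesis by (simp add: y_def)
  qed
  then have "i \<in> hit x j" using i by (simp add: hit_def)
  moreover have "u i $ j \<le> t" "t \<le> u i $ j + a i" using y[of j] by (auto simp: y_def)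
  ultimately show ?thesis by blast
qed

lemma sum_hit:
  assumes "generic x"
  shows "sum a (hit x j) = s"
  using finite_hit s_pos
proof (rule sum_lengths_tiled_interval[where u = "\<lambda>i. u i $ j", OF _ less_imp_le])
  show "0 \<le> a i" if "i \<in> hit x j" for i
    using that side_pos by (auto simp: hit_def less_imp_le)
  show "0 \<le> u i $ j \<and> u i $ j + a i \<le> s" if "i \<in> hit x j" for i
    using that corner_bounds by (auto simp: hit_def)
qed (use hit_separated hit_cover[OF assms] in auto)

text \<open>Cubes on the line that start before cube \<open>i\<close> must end by its lower face,
  and every point before that face lies in one of them. They therefore tile the segment from 0 to
  \<open>u i $ j\<close>.\<close>

lemma sum_hit_below:
  assumes "generic x" and i: "i \<in> hit x j"
  shows "sum a {i' \<in> hit x j. u i' $ j < u i $ j} = u i $ j"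
proof (rule sum_lengths_tiled_interval[where u = "\<lambda>i. u i $ j"])
  have "i < n" using i by (simp add: hit_def)
  show "finite {i' \<in> hit x j. u i' $ j < u i $ j}" using finite_hit by simp
  show "0 \<le> u i $ j" using corner_bounds \<open>i < n\<close> by blast
  show "0 \<le> a i'" if "i' \<in> {i' \<in> hit x j. u i' $ j < u i $ j}" for i'
    using that side_pos by (auto simp: hit_def less_imp_le)
  show "0 \<le> u i' $ j \<and> u i' $ j + a i' \<le> u i $ j" if "i' \<in> {i' \<in> hit x j. u i' $ j < u i $ j}" for i'
    using that hit_separated[of i' x j i] i corner_bounds[of i'] side_pos[OF \<open>i < n\<close>]
    by (auto simp: hit_def)
  show "\<exists>i'\<in>{i' \<in> hit x j. u i' $ j < u i $ j}. u i' $ j \<le> t \<and> t \<le> u i' $ j + a i'"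
    if "0 \<le> t" "t < u i $ j" for t
  proof -
    have "t \<le> s" using that corner_bounds[OF \<open>i < n\<close>, of j] side_pos[OF \<open>i < n\<close>] by linarith
    with hit_cover[OF assms(1) that(1), of j] that show ?thesis by fastforce
  qed
qed (use hit_separated in auto)

lemma generic_hit_exists:
  assumes "i < n"
  obtains x where "generic x" "i \<in> hit x j"
proof -
  have "\<exists>t. u i $ l < t \<and> t < u i $ l + a i \<and> (\<forall>i'<n. t \<noteq> u i' $ l \<and> t \<noteq> u i' $ l + a i')" for l
  proof -
    let ?Z = "(\<lambda>i'. u i' $ l) ` {..<n} \<union> (\<lambda>i'. u i' $ l + a i') ` {..<n}"
    \<comment> \<open>Each coordinate is chosen strictly inside the side of cube \<open>i\<close>,
      avoiding finitely many face positions; the resulting point serves for every direction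
      \<open>j\<close>.\<close>
    have "infinite ({u i $ l <..< u i $ l + a i} - ?Z)"
      using side_pos[OF assms] by (intro Diff_infinite_finite) auto
    then obtain t where "t \<in> {u i $ l <..< u i $ l + a i} - ?Z"
      by (metis finite.emptyI ex_in_conv)
    then show ?thesis by (intro exI[of _ t]) auto
  qed
  then obtain t where t: "\<And>l. u i $ l < t l" "\<And>l. t l < u i $ l + a i"
    and avoid: "\<And>l i'. i' < n \<Longrightarrow> t l \<noteq> u i' $ l \<and> t l \<noteq> u i' $ l + a i'" by metis
  have "0 \<le> t l" "t l \<le> s" for l
    using t[of l] corner_bounds[OF assms, of l] by linarith+
  then have "generic (\<chi> l. t l)"
    using avoid by (auto simp: generic_def mem_box_cart)
  moreover have "i \<in> hit (\<chi> l. t l) j"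
    using t assms by (auto simp: hit_def)
  ultimately show thesis by (rule that)
qed

section \<open>Volumes and integrals over the large cube\<close>

lemma negligible_nongeneric: "negligible (cbox 0 (\<chi> l. s) - {x. generic x})"
proof (rule negligible_subset)
  show "negligible (\<Union>l. \<Union>i<n. {x :: real ^ 'd. x $ l = u i $ l} \<union> {x. x $ l = u i $ l + a i})"
    by (auto intro!: negligible_Un negligible_Union negligible_coordinate_hyperplane)
  show "cbox 0 (\<chi> l. s) - {x. generic x} \<subseteq>
      (\<Union>l. \<Union>i<n. {x :: real ^ 'd. x $ l = u i $ l} \<union> {x. x $ l = u i $ l + a i})"
    by (auto simp: generic_def)
qed

lemma sum_volumes: "(\<Sum>i<n. a i ^ CARD('d)) = s ^ CARD('d)"
proof -
  have content: "measure lebesgue (cbox v (\<chi> l. v $ l + c)) = c ^ CARD('d)" if "c > 0" for v :: "real ^ 'd" and c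
  proof -
    have "cbox v (\<chi> l. v $ l + c) \<noteq> {}" using that by (simp add: interval_ne_empty_cart)
    then show ?thesis by (simp add: content_cbox_cart measure_completion)
  qed
  have "measure lebesgue (\<Union>i\<in>{..<n}. cbox (u i) (\<chi> l. u i $ l + a i)) =
      (\<Sum>i<n. measure lebesgue (cbox (u i) (\<chi> l. u i $ l + a i)))"
  proof (rule measure_negligible_finite_Union_image)
    show "pairwise (\<lambda>i i'. negligible (cbox (u i) (\<chi> l. u i $ l + a i) \<inter> cbox (u i') (\<chi> l. u i' $ l + a i'))) {..<n}"
    proof (rule pairwiseI)
      fix i i' assume "i \<in> {..<n}" "i' \<in> {..<n}" "i \<noteq> i'"
      then obtain l where l: "u i $ l + a i \<le> u i' $ l \<or> u i' $ l + a i' \<le> u i $ l"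
        using separated[of i i'] by auto
      have "cbox (u i) (\<chi> l. u i $ l + a i) \<inter> cbox (u i') (\<chi> l. u i' $ l + a i') \<subseteq>
          {x. x $ l = u i $ l} \<union> {x. x $ l = u i' $ l}"
        using l by (force simp: mem_box_cart dest: spec[of _ l])
      then show "negligible (cbox (u i) (\<chi> l. u i $ l + a i) \<inter> cbox (u i') (\<chi> l. u i' $ l + a i'))"
        by (rule negligible_subset[rotated]) (intro negligible_Un negligible_coordinate_hyperplane)
    qed
  qed auto
  then show ?thesis
    unfolding cover using content[OF s_pos, of 0] content[OF side_pos] by simp
qed

text \<open>Double counting: a generic point lies in exactly those stretched boxes
  \<open>B i\<close> whose cubes its line in direction \<open>j\<close> hits. Hence the indicators
  of the \<open>B i\<close> sum to \<open>k\<close> almost everywhere on the large cube, and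
  integration gives the equation.\<close>

lemma sum_facet_areas:
  assumes k: "\<And>x. generic x \<Longrightarrow> card (hit x j) = k"
  shows "(\<Sum>i<n. a i ^ (CARD('d) - 1)) * s = real k * s ^ CARD('d)"
proof -
  \<comment> \<open>Cube \<open>i\<close> stretched in direction \<open>j\<close> to the full length
    \<open>s\<close>.\<close>
  define B where "B i = cbox (\<chi> l. if l = j then 0 else u i $ l) (\<chi> l. if l = j then s else u i $ l + a i)" for i
  let ?Q = "cbox 0 (\<chi> l. s) :: (real ^ 'd) set"
  have content_B: "measure lebesgue (B i) = a i ^ (CARD('d) - 1) * s" if "i < n" for i
  proof -
    have "B i \<noteq> {}"
      using s_pos side_pos[OF that] by (auto simp: B_def interval_ne_empty_cart less_imp_le)
    then have "measure lebesgue (B i) =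
        (\<Prod>l\<in>UNIV. (if l = j then s else u i $ l + a i) - (if l = j then 0 else u i $ l))"
      unfolding B_def by (simp add: content_cbox_cart measure_completion)
    also have "\<dots> = (\<Prod>l\<in>UNIV. if l = j then s else a i)"
      by (rule prod.cong) auto
    also have "\<dots> = s * (\<Prod>l\<in>UNIV - {j}. if l = j then s else a i)"
      by (subst prod.remove[of _ j]) auto
    also have "(\<Prod>l\<in>UNIV - {j}. if l = j then s else a i) = (\<Prod>l\<in>UNIV - {j}. a i)"
      by (rule prod.cong) auto
    finally show ?thesis by (simp add: card_Diff_singleton mult.commute)
  qed
  have "B i \<in> lmeasurable" for i by (simp add: B_def)
  then have integrable_B: "integrable lebesgue (indicat_real (B i))" for i
    unfolding fmeasurable_def by (intro integrable_real_indicator) blast+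
  have content_Q: "measure lebesgue ?Q = s ^ CARD('d)"
  proof -
    have "?Q \<noteq> {}" using s_pos by (simp add: interval_ne_empty_cart)
    then show ?thesis by (simp add: content_cbox_cart measure_completion)
  qed
  have B_sub: "B i \<subseteq> ?Q" if "i < n" for i
  proof
    fix x assume "x \<in> B i"
    then have "(if l = j then 0 else u i $ l) \<le> x $ l" "x $ l \<le> (if l = j then s else u i $ l + a i)" for l
      by (auto simp: B_def mem_box_cart)
    then have "0 \<le> x $ l \<and> x $ l \<le> s" for l
      using corner_bounds[OF that, of l] by (smt (verit))
    then show "x \<in> ?Q" by (simp add: mem_box_cart)
  qed
  have count: "(\<Sum>i<n. indicator (B i) x) = real k * indicator ?Q x"
    if "x \<notin> ?Q - {x. generic x}" for x
  proof (cases "generic x")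
    case True
    then have x: "x \<in> ?Q" by (simp add: generic_def)
    have "x \<in> B i \<longleftrightarrow> i \<in> hit x j" if "i < n" for i
    proof -
      have "x \<in> B i \<longleftrightarrow> (\<forall>l. l \<noteq> j \<longrightarrow> u i $ l \<le> x $ l \<and> x $ l \<le> u i $ l + a i)"
        using x by (auto simp: B_def mem_box_cart)
      also have "\<dots> \<longleftrightarrow> i \<in> hit x j"
      proof -
        have "u i $ l \<noteq> x $ l" "x $ l \<noteq> u i $ l + a i" for l
          using that True unfolding generic_def by metis+
        then show ?thesis using that by (auto simp: hit_def less_le)
      qed
      finally show ?thesis .
    qed
    then have "(\<Sum>i<n. indicator (B i) x) = (\<Sum>i<n. if i \<in> hit x j then 1 else 0 :: real)"
      by (intro sum.cong) (auto simp: indicator_def)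
    also have "\<dots> = real (card ({..<n} \<inter> hit x j))"
      by (simp add: sum.If_cases)
    also have "{..<n} \<inter> hit x j = hit x j" by (auto simp: hit_def)
    finally show ?thesis using k[OF True] x by simp
  next
    case False
    then have "x \<notin> ?Q" using that by simp
    moreover have "x \<notin> B i" if "i < n" for i using B_sub[OF that] \<open>x \<notin> ?Q\<close> by blast
    ultimately show ?thesis by simp
  qed
  have "(\<Sum>i<n. a i ^ (CARD('d) - 1)) * s = (\<Sum>i<n. measure lebesgue (B i))"
    using content_B by (simp add: sum_distrib_right)
  also have "\<dots> = (\<Sum>i<n. \<integral>x. indicator (B i) x \<partial>lebesgue)"
    by simp
  also have "\<dots> = (\<integral>x. (\<Sum>i<n. indicator (B i) x) \<partial>lebesgue)"
    using integrable_B by (intro Bochner_Integration.integral_sum[symmetric])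
  also have "\<dots> = (\<integral>x. real k * indicator ?Q x \<partial>lebesgue)"
  proof (rule integral_cong_AE)
    show "AE x in lebesgue. (\<Sum>i<n. indicator (B i) x) = real k * indicator ?Q x"
      using negligible_nongeneric count
      by (intro AE_I'[of "?Q - {x. generic x}"]) (auto simp: negligible_iff_null_sets)
    show "(\<lambda>x. \<Sum>i<n. indicat_real (B i) x) \<in> borel_measurable lebesgue"
      using integrable_B by (intro borel_measurable_sum borel_measurable_integrable)
    show "(\<lambda>x. real k * indicat_real ?Q x) \<in> borel_measurable lebesgue"
      by (intro measurable_completion) measurable
  qed
  also have "\<dots> = real k * s ^ CARD('d)"
    using content_Q by simp
  finally show ?thesis .
qed

section \<open>Consequences of the bounds on the side lengths\<close>

context
  fixes N :: real
  assumes N_pos: "N > 0" and s_le: "s \<le> N"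
    and side_gt: "\<And>i. i < n \<Longrightarrow> N / (N + 1) < a i" and side_le: "\<And>i. i < n \<Longrightarrow> a i \<le> 1"
begin

text \<open>The sides on the line sum to \<open>s\<close>. Sides at most 1 make the count at least
  \<open>s\<close>; sides above \<open>N / (N + 1)\<close> make it less than
  \<open>s + s / N\<close>, which is at most \<open>s + 1\<close>.\<close>

lemma card_hit:
  assumes "generic x"
  shows "card (hit x j) = nat \<lceil>s\<rceil>"
proof -
  let ?k = "real (card (hit x j))"
  have "hit x j \<noteq> {}" using sum_hit[OF assms, of j] s_pos by auto
  have "s \<le> ?k"
    using sum_bounded_above[of "hit x j" a 1] side_le sum_hit[OF assms, of j] by (auto simp: hit_def)
  moreover have "?k * (N / (N + 1)) < s"
    using sum_strict_mono[of "hit x j" "\<lambda>_. N / (N + 1)" a] \<open>hit x j \<noteq> {}\<close> finite_hit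
      side_gt sum_hit[OF assms, of j] by (auto simp: hit_def)
  then have "?k < s + s / N" using N_pos by (simp add: field_simps)
  moreover have "s / N \<le> 1" using s_le N_pos by simp
  ultimately have "s \<le> ?k" "?k < s + 1" by simp_all
  then have "\<lceil>s\<rceil> = int (card (hit x j))" by (intro ceiling_unique) auto
  then show ?thesis by simp
qed

text \<open>The level \<open>q\<close> is the number of cubes before cube \<open>i\<close> on a
  generic line through it. It is strictly below the total count because cube \<open>i\<close> is
  itself on the line, and \<open>u i $ j\<close> is the sum of those \<open>q\<close> sides.\<close>

lemma level_exists:
  assumes "i < n"
  shows "\<exists>q < nat \<lceil>s\<rceil>. real q * (N / (N + 1)) \<le> u i $ j \<and> u i $ j \<le> real q"
proof -
  obtain x where x: "generic x" "i \<in> hit x j" using generic_hit_exists[OF assms] .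
  let ?L = "{i' \<in> hit x j. u i' $ j < u i $ j}"
  have "?L \<subset> hit x j" using x by auto
  then have "card ?L < nat \<lceil>s\<rceil>"
    using card_hit[OF x(1)] psubset_card_mono[OF finite_hit] by metis
  moreover have "real (card ?L) * (N / (N + 1)) \<le> sum a ?L"
    using sum_bounded_below[of ?L "N / (N + 1)" a] side_gt by (auto simp: hit_def less_imp_le)
  moreover have "sum a ?L \<le> real (card ?L)"
    using sum_bounded_above[of ?L a 1] side_le by (auto simp: hit_def)
  ultimately show ?thesis using sum_hit_below[OF x] by auto
qed

text \<open>Counting the cubes below a cube in each coordinate direction gives a vector of \<open>d\<close>
  levels below \<open>\<lceil>s\<rceil>\<close>, and cubes separated along an axis have different levels on it.\<close>

lemma card_cubes_le: "n \<le> nat \<lceil>s\<rceil> ^ CARD('d)"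
proof -
  obtain q where q: "\<And>i j. i < n \<Longrightarrow> q i j < nat \<lceil>s\<rceil>"
    and lower: "\<And>i j. i < n \<Longrightarrow> real (q i j) * (N / (N + 1)) \<le> u i $ j"
    and upper: "\<And>i j. i < n \<Longrightarrow> u i $ j \<le> real (q i j)"
    using level_exists by metis
  have less: "q i j < q i' j" if i: "i < n" "i' < n" and le: "u i $ j + a i \<le> u i' $ j" for i i' j
  proof -
    \<comment> \<open>The bound \<open>q i j < N\<close> is exactly what makes \<open>q i j\<close>
      smaller than \<open>q i j + 1\<close> sides of length \<open>N / (N + 1)\<close>. So a cube
      beginning after cube \<open>i\<close> ends begins beyond \<open>q i j\<close>, and its own
      level exceeds \<open>q i j\<close>.\<close>
    have "q i j + 1 \<le> nat \<lceil>s\<rceil>" using q[OF i(1), of j] by simp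
    then have "real (q i j) < s" using s_pos by linarith
    then have "real (q i j) < N" using s_le by simp
    then have "real (q i j) < (real (q i j) + 1) * (N / (N + 1))"
      using N_pos by (simp add: field_simps)
    also have "\<dots> = real (q i j) * (N / (N + 1)) + N / (N + 1)" by (simp only: distrib_right mult_1_left)
    also have "\<dots> \<le> u i $ j + a i" using lower[OF i(1), of j] side_gt[OF i(1)] by linarith
    also have "\<dots> \<le> real (q i' j)" using le upper[OF i(2), of j] by linarith
    finally show ?thesis by simp
  qed
  have "inj_on q {..<n}"
  proof (rule inj_onI, rule ccontr)
    fix i i' assume i: "i \<in> {..<n}" "i' \<in> {..<n}" "q i = q i'" "i \<noteq> i'"
    then obtain j where "u i $ j + a i \<le> u i' $ j \<or> u i' $ j + a i' \<le> u i $ j"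
      using separated[of i i'] by auto
    then show False using less[of i i' j] less[of i' i j] i by auto
  qed
  then have "n = card (q ` {..<n})" by (simp add: card_image)
  also have "\<dots> \<le> card (PiE UNIV (\<lambda>_ :: 'd. {..<nat \<lceil>s\<rceil>}))"
    using q by (intro card_mono finite_PiE) auto
  also have "\<dots> = nat \<lceil>s\<rceil> ^ CARD('d)" by (simp add: card_PiE)
  finally show ?thesis .
qed

lemma card_cubes_eq:
  assumes "CARD('d) \<ge> 2"
  shows "n = nat \<lceil>s\<rceil> ^ CARD('d)" and "i < n \<Longrightarrow> real (nat \<lceil>s\<rceil>) * a i = s"
proof -
  define k where "k = real (nat \<lceil>s\<rceil>)"
  have "k > 0" using s_pos by (simp add: k_def)
  define m where "m = CARD('d) - 1"
  have m: "CARD('d) = Suc m" "m > 0" using assms by (auto simp: m_def)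
  \<comment> \<open>This scaling gives the power sums of exponents \<open>m\<close> and
    \<open>Suc m\<close> the same value \<open>k ^ Suc m\<close>, so the sum of
    \<open>\<phi>\<close> collapses to \<open>real n - k ^ Suc m\<close>.\<close>
  define t where "t i = k * a i / s" for i
  have t_nonneg: "t i \<ge> 0" if "i < n" for i
    using side_pos[OF that] s_pos \<open>k > 0\<close> by (simp add: t_def)
  define \<phi> where "\<phi> x = real m * x ^ Suc m - real (Suc m) * x ^ m + 1" for x
  have "(\<Sum>i<n. t i ^ Suc m) = (k / s) ^ Suc m * (\<Sum>i<n. a i ^ Suc m)"
    unfolding sum_distrib_left by (simp add: t_def power_mult_distrib power_divide mult_ac)
  also have "\<dots> = k ^ Suc m"
    using sum_volumes s_pos by (simp add: m power_divide)
  finally have sum_Suc: "(\<Sum>i<n. t i ^ Suc m) = k ^ Suc m" .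
  have "(\<Sum>i<n. a i ^ m) * s = k * s ^ Suc m"
    using sum_facet_areas[OF card_hit] by (simp add: m k_def)
  then have "(\<Sum>i<n. a i ^ m) = k * s ^ m" using s_pos by simp
  moreover have "(\<Sum>i<n. t i ^ m) = (k / s) ^ m * (\<Sum>i<n. a i ^ m)"
    unfolding sum_distrib_left by (simp add: t_def power_mult_distrib power_divide mult_ac)
  ultimately have sum_m: "(\<Sum>i<n. t i ^ m) = k ^ Suc m"
    using s_pos by (simp add: power_divide)
  have "(\<Sum>i<n. \<phi> (t i)) = real m * (\<Sum>i<n. t i ^ Suc m) - real (Suc m) * (\<Sum>i<n. t i ^ m) + real n"
    unfolding \<phi>_def by (simp add: sum.distrib sum_subtractf sum_distrib_left del: power_Suc of_nat_Suc)
  also have "\<dots> = real n - k ^ Suc m"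
    unfolding sum_Suc sum_m by (simp add: algebra_simps)
  finally have sum_\<phi>: "(\<Sum>i<n. \<phi> (t i)) = real n - k ^ Suc m" .
  have \<phi>_nonneg: "\<phi> (t i) \<ge> 0" if "i \<in> {..<n}" for i
    using tangent_line_power(1)[OF t_nonneg] that unfolding \<phi>_def by blast
  have "real n \<le> real (nat \<lceil>s\<rceil> ^ CARD('d))"
    using card_cubes_le by (rule of_nat_mono)
  then have le: "real n \<le> k ^ Suc m" by (simp only: m k_def of_nat_power)
  moreover have "0 \<le> (\<Sum>i<n. \<phi> (t i))" using \<phi>_nonneg by (rule sum_nonneg)
  \<comment> \<open>The level count gives \<open>n\<close> at most \<open>k ^ Suc m\<close> and
    nonnegativity of \<open>\<phi>\<close> gives the reverse; equality forces every
    \<open>\<phi> (t i)\<close> to vanish.\<close>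
  ultimately have n: "real n = k ^ Suc m" and zero: "(\<Sum>i<n. \<phi> (t i)) = 0"
    using sum_\<phi> by auto
  from n have "real n = real (nat \<lceil>s\<rceil> ^ CARD('d))" by (simp only: m k_def of_nat_power)
  then show "n = nat \<lceil>s\<rceil> ^ CARD('d)" by (simp only: of_nat_eq_iff)
  show "real (nat \<lceil>s\<rceil>) * a i = s" if "i < n"
  proof -
    have "\<phi> (t i) = 0"
      using zero \<phi>_nonneg that by (subst (asm) sum_nonneg_eq_0_iff) auto
    then have "t i = 1"
      using tangent_line_power(2)[OF t_nonneg[OF that] \<open>m > 0\<close>] unfolding \<phi>_def by fastforce
    then show ?thesis using s_pos by (simp add: t_def k_def)
  qed
qed

end

end

text \<open>If no axis separated the boxes, their open sides would overlap in every coordinate, and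
  choosing a value in each overlap would give a common interior point.\<close>

lemma disjoint_interior_cbox_separated:
  fixes u v u' v' :: "real ^ 'd"
  assumes "interior (cbox u v) \<inter> interior (cbox u' v') = {}"
    and "\<And>l. u $ l < v $ l" "\<And>l. u' $ l < v' $ l"
  shows "\<exists>l. v $ l \<le> u' $ l \<or> v' $ l \<le> u $ l"
proof (rule ccontr)
  assume "\<not> ?thesis"
  then have "max (u $ l) (u' $ l) < min (v $ l) (v' $ l)" for l
    using assms(2,3)[of l] by (auto simp: not_le)
  then have "\<forall>l. \<exists>t. max (u $ l) (u' $ l) < t \<and> t < min (v $ l) (v' $ l)"
    using dense by blast
  then obtain t where "max (u $ l) (u' $ l) < t l \<and> t l < min (v $ l) (v' $ l)" for l
    by metis
  then have "(\<chi> l. t l) \<in> box u v \<inter> box u' v'" by (auto simp: mem_box_cart)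
  with assms(1) show False by (auto simp: interior_cbox)
qed

theorem theorem1:
  fixes Q :: "(real ^ 'd) set" and s :: real
    and n :: nat and C :: "nat \<Rightarrow> (real ^ 'd) set" and a :: "nat \<Rightarrow> real"
  assumes "CARD('d) \<ge> 2" and "n \<ge> 2"
    and "is_cube s Q"
    and "cube_decomposition Q n C a"
    and "\<forall>i<n. a i \<in> {1 - 1 / (real n powr (1 / real CARD('d)) + 1) <.. 1}"
  shows "(\<exists>m::nat. m > 0 \<and> n = m ^ CARD('d)) \<and> (\<forall>i<n. \<forall>j<n. a i = a j)"
proof -
  obtain f :: "real ^ 'd \<Rightarrow> real ^ 'd" and p where s: "s > 0"
    and f: "orthogonal_transformation f" and Q: "Q = (\<lambda>x. p + f x) ` cbox 0 (\<chi> i. s)"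
    using \<open>is_cube s Q\<close> unfolding is_cube_def by blast
  \<comment> \<open>The decomposition is pulled back along the motion that placed
    \<open>Q\<close>.\<close>
  define D where "D i = (\<lambda>x. inv f (x - p)) ` C i" for i
  have "(\<lambda>x. inv f (x - p)) ` Q = cbox 0 (\<chi> i. s)"
    unfolding Q image_image using orthogonal_transformation_inj[OF f] by simp
  then have D: "cube_decomposition (cbox 0 (\<chi> i. s)) n D a"
    using cube_decomposition_rigid_image[OF orthogonal_transformation_inv[OF f] assms(4), of p]
    unfolding D_def by simp
  obtain u where u: "\<And>i. i < n \<Longrightarrow> D i = cbox (u i) (\<chi> l. u i $ l + a i)"
    using cube_decomposition_cbox_parallel[OF D] by metis
  have a_pos: "0 < a i" if "i < n" for i
    using D that unfolding cube_decomposition_def is_cube_def by blast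
  interpret cube_tiling s n u a
  proof
    show "(\<Union>i<n. cbox (u i) (\<chi> l. u i $ l + a i)) = cbox 0 (\<chi> l. s)"
      using D u unfolding cube_decomposition_def by auto
    show "\<exists>l. u i $ l + a i \<le> u i' $ l \<or> u i' $ l + a i' \<le> u i $ l"
      if "i < n" "i' < n" "i \<noteq> i'" for i i'
      using disjoint_interior_cbox_separated[of "u i" "\<chi> l. u i $ l + a i" "u i'" "\<chi> l. u i' $ l + a i'"]
        D that a_pos u unfolding cube_decomposition_def by auto
  qed (use s a_pos in auto)
  define N where "N = real n powr (1 / real CARD('d))"
  have "N > 0" using \<open>n \<ge> 2\<close> by (simp add: N_def)
  have N_power: "N ^ CARD('d) = real n"
    using \<open>n \<ge> 2\<close> by (simp add: N_def powr_power)
  have side: "N / (N + 1) < a i" "a i \<le> 1" if "i < n" for i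
  proof -
    have "1 - 1 / (N + 1) = N / (N + 1)" using \<open>N > 0\<close> by (simp add: field_simps)
    then show "N / (N + 1) < a i" "a i \<le> 1" using assms(5) that by (auto simp: N_def)
  qed
  \<comment> \<open>Volume comparison: \<open>n\<close> cubes of side at most 1 have total volume at
    most \<open>n\<close>, which is \<open>N ^ CARD('d)\<close>.\<close>
  have "s ^ CARD('d) = (\<Sum>i<n. a i ^ CARD('d))" by (rule sum_volumes[symmetric])
  also have "\<dots> \<le> (\<Sum>i<n. 1)"
    using a_pos side by (intro sum_mono power_le_one) (auto simp: less_imp_le)
  finally have "s ^ CARD('d) \<le> N ^ CARD('d)" by (simp add: N_power)
  then have "s \<le> N" using \<open>N > 0\<close> by (simp add: power_mono_iff s less_imp_le)
  note eq = card_cubes_eq[OF \<open>N > 0\<close> \<open>s \<le> N\<close> side \<open>CARD('d) \<ge> 2\<close>]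
  have "nat \<lceil>s\<rceil> > 0" using s by simp
  moreover have "a i = a j" if "i < n" "j < n" for i j
  proof -
    have "real (nat \<lceil>s\<rceil>) * a i = real (nat \<lceil>s\<rceil>) * a j" using eq(2) that by simp
    with \<open>nat \<lceil>s\<rceil> > 0\<close> show ?thesis
      by (metis mult_left_cancel of_nat_eq_0_iff less_irrefl)
  qed
  ultimately show ?thesis using eq(1) by blast
qed

end
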